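(* Let $C_{k,n}$ be the cone of copositive tensors and $CP_{k,n}$ the cone of completely positive tensors, both of order $k$ and dimension $n$, in the space $S_{k,n}$ of real symmetric tensors of order $k$ and dimension $n$. Then $C_{k,n} = CP_{k,n}^*$ and $C_{k,n}^* = \mathrm{cl}\, CP_{k,n}$ (the closure of $CP_{k,n}$). In particular, if $CP_{k,n}$ is closed, then $C_{k,n}^* = CP_{k,n}$.
   Context: A real $k$th order $n$-dimensional tensor is an array $\mathcal{A}=(a_{i_1\cdots i_k})$ of real numbers, $i_1,\dots,i_k\in\{1,\dots,n\}$; it is symmetric if its entries are invariant under every permutation of the indices. For a vector $x$, $\mathcal{A}x^k = \sum_{i_1,\dots,i_k=1}^n a_{i_1\cdots i_k}x_{i_1}\cdots x_{i_k}$. $\mathbb{R}^n_+$ is the set of vectors in $\mathbb{R}^n$ with all components nonnegative. $\mathcal{A}\in S_{k,n}$ is copositive if $\mathcal{A}x^k\ge 0$ for all $x\in\mathbb{R}^n_+$. For $y\in\mathbb{R}^n_+$, $y^k$ denotes the tensor $(y_{i_1}\cdots y_{i_k})$. A tensor $\mathcal{A}$ is completely positive if there are finitely many $y^{(1)},\dots,y^{(r)}\in\mathbb{R}^n_+$ with $\mathcal{A}=\sum_{i=1}^r (y^{(i)})^k$. The inner product on $S_{k,n}$ is $\langle\mathcal{A},\mathcal{B}\rangle=\sum_{i_1,\dots,i_k=1}^n a_{i_1\cdots i_k}b_{i_1\cdots i_k}$. For a convex cone $K\subseteq S_{k,n}$, the dual cone is $K^*=\{\mathcal{B}\in S_{k,n}:\langle\mathcal{A},\mathcal{B}\rangle\ge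 0 \text{ for all }\mathcal{A}\in K\}$. *)

theory Defs
  imports "HOL-Analysis.Analysis"
begin

text \<open>
  Order and dimension are the cardinalities of the finite index types \<open>'k\<close> and \<open>'n\<close>: a
  multi-index \<open>(i\<^sub>1, \<dots>, i\<^sub>k)\<close> is a function \<open>i :: 'k \<Rightarrow> 'n\<close>, and a tensor is a vector indexed by
  multi-indices. The library inner product and topology on this type are then the
  entrywise inner product (see \<open>inner_tensor\<close> below) and its norm topology.
\<close>

type_synonym ('k, 'n) tensor = "(real, 'k \<Rightarrow> 'n) vec"

lemma inner_tensor:
  fixes A B :: "('k::finite, 'n::finite) tensor"
  shows "A \<bullet> B = (\<Sum>i\<in>UNIV. A $ i * B $ i)"
  by (simp add: inner_vec_def)

definition sym_tensors :: "('k::finite, 'n::finite) tensor set" where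
  "sym_tensors = {A. \<forall>p i. bij p \<longrightarrow> A $ (i \<circ> p) = A $ i}"

definition nonneg_vecs :: "(real ^ 'n) set" where
  "nonneg_vecs = {x. \<forall>j. 0 \<le> x $ j}"

definition tensor_form :: "('k::finite, 'n::finite) tensor \<Rightarrow> real ^ 'n \<Rightarrow> real" where
  "tensor_form A x = (\<Sum>i\<in>UNIV. A $ i * (\<Prod>j\<in>UNIV. x $ i j))"

definition tensor_power :: "real ^ 'n \<Rightarrow> ('k::finite, 'n::finite) tensor" where
  "tensor_power y = (\<chi> i. \<Prod>j\<in>UNIV. y $ i j)"

definition copositive :: "('k::finite, 'n::finite) tensor \<Rightarrow> bool" where
  "copositive A \<longleftrightarrow> (\<forall>x\<in>nonneg_vecs. 0 \<le> tensor_form A x)"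

definition completely_positive :: "('k::finite, 'n::finite) tensor \<Rightarrow> bool" where
  "completely_positive A \<longleftrightarrow>
     (\<exists>(r::nat) y. (\<forall>l\<in>{1..r}. y l \<in> nonneg_vecs) \<and> A = (\<Sum>l=1..r. tensor_power (y l)))"

definition copositive_cone :: "('k::finite, 'n::finite) tensor set" where
  "copositive_cone = {A \<in> sym_tensors. copositive A}"

definition completely_positive_cone :: "('k::finite, 'n::finite) tensor set" where
  "completely_positive_cone = {A \<in> sym_tensors. completely_positive A}"

text \<open>The dual is taken inside the space of symmetric tensors.\<close>

definition tensor_dual :: "('k::finite, 'n::finite) tensor set \<Rightarrow> ('k, 'n) tensor set" where
  "tensor_dual K = {B \<in> sym_tensors. \<forall>A\<in>K. 0 \<le> A \<bullet> B}"

end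

theory Submission imports Defs begin

text \<open>
  The form of a tensor is its inner product with a power tensor, which gives the first equality
  and the inclusion of the closure in the dual. Conversely, let \<open>X\<close> be a symmetric tensor outside
  the closure of the completely positive cone, and let \<open>c\<close> be the point of the closure closest
  to \<open>X\<close>. Then \<open>c - X\<close> is copositive and has negative inner product with \<open>X\<close>; it is
  symmetric because \<open>c\<close> and \<open>X\<close> are, so that a separating tensor need not be symmetrized.
\<close>

lemma tensor_form_eq_inner: "tensor_form A x = tensor_power x \<bullet> A"
  by (simp add: tensor_form_def tensor_power_def inner_tensor mult.commute)

lemma subspace_sym_tensors: "subspace sym_tensors"
  by (auto simp: subspace_def sym_tensors_def)

lemma tensor_power_sym: "tensor_power y \<in> sym_tensors"
proof -
  have "(\<Prod>j\<in>UNIV. y $ i (p j)) = (\<Prod>j\<in>UNIV. y $ i j)" if "bij p" for p :: "'a \<Rightarrow> 'a" and i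
    using that by (rule prod.reindex_bij_betw)
  then show ?thesis
    by (simp add: sym_tensors_def tensor_power_def)
qed

lemma tensor_power_scaleR:
  "(tensor_power (t *\<^sub>R y) :: ('k::finite, 'n::finite) tensor) = t ^ CARD('k) *\<^sub>R tensor_power y"
  by (simp add: tensor_power_def vec_eq_iff prod.distrib)

lemma nonneg_vecs_scaleR: "y \<in> nonneg_vecs \<Longrightarrow> 0 \<le> t \<Longrightarrow> t *\<^sub>R y \<in> nonneg_vecs"
  by (simp add: nonneg_vecs_def)

lemma completely_positive_0: "completely_positive 0"
  unfolding completely_positive_def by (rule exI[of _ 0]) simp

lemma completely_positive_add_power:
  assumes "completely_positive A" and z: "z \<in> nonneg_vecs"
  shows "completely_positive (A + tensor_power z)"
proof -
  obtain r y where y: "\<forall>l\<in>{1..r::nat}. y l \<in> nonneg_vecs" and A: "A = (\<Sum>l=1..r. tensor_power (y l))"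
    using assms(1) unfolding completely_positive_def by blast
  \<comment> \<open>The slot \<open>Suc r\<close> lies outside \<open>{1..r}\<close>, so storing
    \<open>z\<close> there leaves the old sum unchanged.\<close>
  have "(\<Sum>l=1..r. tensor_power ((y(Suc r := z)) l)) = A"
    unfolding A by (rule sum.cong) auto
  then have "A + tensor_power z = (\<Sum>l=1..Suc r. tensor_power ((y(Suc r := z)) l))"
    by simp
  moreover have "\<forall>l\<in>{1..Suc r}. (y(Suc r := z)) l \<in> nonneg_vecs"
    using y z by auto
  ultimately show ?thesis
    unfolding completely_positive_def by blast
qed

text \<open>Trades the existential family and its index range for adding one power at a time; linear
  arguments about the cone then need only a single summand.\<close>

lemma completely_positive_induct [consumes 1, case_names zero add]:
  assumes "completely_positive A" and "P 0"
    and step: "\<And>A y. completely_positive A \<Longrightarrow> P A \<Longrightarrow> y \<in> nonneg_vecs \<Longrightarrow> P (A + tensor_power y)"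
  shows "P A"
proof -
  obtain r y where y: "\<forall>l\<in>{1..r::nat}. y l \<in> nonneg_vecs" and A: "A = (\<Sum>l=1..r. tensor_power (y l))"
    using assms(1) unfolding completely_positive_def by blast
  \<comment> \<open>The induction runs over partial sums. The bound \<open>m \<le> r\<close> keeps
    each \<open>y l\<close> nonnegative, and complete positivity is carried along because
    \<open>step\<close> asks for it.\<close>
  have "completely_positive S \<and> P S" if "S = (\<Sum>l=1..m. tensor_power (y l))" "m \<le> r" for m S
    using that
  proof (induction m arbitrary: S)
    case 0
    then show ?case using \<open>P 0\<close> completely_positive_0 by simp
  next
    case (Suc m)
    then show ?case using y by (auto intro!: step completely_positive_add_power)
  qed
  then show ?thesis using A by blast
qed

lemma completely_positive_imp_sym: "completely_positive A \<Longrightarrow> A \<in> sym_tensors"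
  by (induction rule: completely_positive_induct)
    (auto intro: subspace_add subspace_0 subspace_sym_tensors tensor_power_sym)

lemma completely_positive_add:
  assumes "completely_positive A" "completely_positive B"
  shows "completely_positive (A + B)"
  \<comment> \<open>The order of the facts makes the induction consume \<open>B\<close>: its powers
    are appended to \<open>A\<close> one by one.\<close>
  using assms(2,1)
  by (induction rule: completely_positive_induct)
    (auto simp: add.assoc[symmetric] intro: completely_positive_add_power)

lemma completely_positive_scaleR:
  fixes A :: "('k::finite, 'n::finite) tensor"
  assumes "completely_positive A" "0 \<le> t"
  shows "completely_positive (t *\<^sub>R A)"
  using assms(1)
proof (induction rule: completely_positive_induct)
  case zero
  then show ?case by (simp add: completely_positive_0)
next
  case (add A y)
  \<comment> \<open>Powers are homogeneous of degree \<open>CARD('k)\<close>, which is positive, so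
    a factor \<open>t \<ge> 0\<close> is absorbed into the vector as its root.\<close>
  let ?s = "root CARD('k) t"
  have "t *\<^sub>R tensor_power y = (tensor_power (?s *\<^sub>R y) :: ('k, 'n) tensor)"
    using \<open>0 \<le> t\<close> by (simp add: tensor_power_scaleR)
  moreover have "?s *\<^sub>R y \<in> nonneg_vecs"
    using add \<open>0 \<le> t\<close> by (simp add: nonneg_vecs_scaleR)
  ultimately show ?case
    using add by (simp add: scaleR_add_right completely_positive_add_power)
qed

lemma completely_positive_cone_eq: "completely_positive_cone = Collect completely_positive"
  by (auto simp: completely_positive_cone_def completely_positive_imp_sym)

lemma tensor_power_completely_positive:
  "y \<in> nonneg_vecs \<Longrightarrow> tensor_power y \<in> completely_positive_cone"
  using completely_positive_add_power[OF completely_positive_0]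
  by (simp add: completely_positive_cone_eq)

lemma cone_completely_positive_cone: "cone completely_positive_cone"
  by (simp add: cone_def completely_positive_cone_eq completely_positive_scaleR)

lemma convex_completely_positive_cone: "convex completely_positive_cone"
  by (simp add: convex_def completely_positive_cone_eq completely_positive_add
      completely_positive_scaleR)

text \<open>By linearity each summand \<open>tensor_power y\<close> contributes
  \<open>tensor_form B y\<close>, which copositivity makes nonnegative.\<close>

lemma copositive_inner_nonneg:
  assumes "copositive B" "completely_positive A"
  shows "0 \<le> A \<bullet> B"
  using assms(2)
proof (induction rule: completely_positive_induct)
  case zero
  then show ?case by simp
next
  case (add A y)
  then show ?case
    using \<open>copositive B\<close> by (simp add: copositive_def tensor_form_eq_inner inner_add_left)
qed

lemma copositive_cone_eq_dual: "copositive_cone = tensor_dual completely_positive_cone"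
proof
  show "copositive_cone \<subseteq> tensor_dual completely_positive_cone"
    by (auto simp: copositive_cone_def tensor_dual_def completely_positive_cone_eq
        copositive_inner_nonneg)
  \<comment> \<open>Testing against single powers of nonnegative vectors is already
    copositivity.\<close>
  show "tensor_dual completely_positive_cone \<subseteq> copositive_cone"
    using tensor_power_completely_positive
    by (fastforce simp: copositive_cone_def tensor_dual_def copositive_def tensor_form_eq_inner)
qed

lemma closed_tensor_dual: "closed (tensor_dual K)"
proof -
  have "tensor_dual K = sym_tensors \<inter> (\<Inter>A\<in>K. {B. A \<bullet> B \<ge> 0})"
    by (auto simp: tensor_dual_def)
  then show ?thesis
    by (simp add: closed_Int closed_INT closed_halfspace_ge closed_subspace[OF subspace_sym_tensors])
qed

text \<open>The bipolar argument for a cone of symmetric tensors.\<close>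

lemma tensor_dual_dual_subset_closure:
  assumes sym: "K \<subseteq> sym_tensors" and "convex K" "cone K" "0 \<in> K"
  shows "tensor_dual (tensor_dual K) \<subseteq> closure K"
proof
  fix X
  assume X: "X \<in> tensor_dual (tensor_dual K)"
  let ?S = "closure K"
  define c where "c = closest_point ?S X"
  have ne: "?S \<noteq> {}" and 0: "0 \<in> ?S"
    using \<open>0 \<in> K\<close> closure_subset by auto
  have c: "c \<in> ?S"
    unfolding c_def using ne by (intro closest_point_in_set) auto
  \<comment> \<open>Variational inequality of the projection: seen from \<open>c\<close>, no point
    of the convex set makes an acute angle with \<open>X\<close>.\<close>
  have ge: "(c - X) \<bullet> (Y - c) \<ge> 0" if "Y \<in> ?S" for Y
    using closest_point_dot[OF convex_closure[OF \<open>convex K\<close>] closed_closure that, of X]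
    by (simp add: c_def inner_diff_left)
  \<comment> \<open>The points \<open>2 *\<^sub>R c\<close> and \<open>0\<close> lie on either side
    of \<open>c\<close> on its ray in the cone; testing \<open>ge\<close> at both forces
    \<open>c - X\<close> to be orthogonal to \<open>c\<close>.\<close>
  have "2 *\<^sub>R c \<in> ?S"
    using cone_closure[OF \<open>cone K\<close>] c by (simp add: cone_def)
  then have "(c - X) \<bullet> c \<ge> 0"
    using ge[of "2 *\<^sub>R c"] by (simp add: scaleR_2)
  moreover have "(c - X) \<bullet> c \<le> 0"
    using ge[OF 0] by simp
  ultimately have orth: "(c - X) \<bullet> c = 0"
    by simp
  have "c \<in> sym_tensors"
    using c closure_minimal[OF sym] closed_subspace[OF subspace_sym_tensors] by blast
  moreover have "X \<in> sym_tensors"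
    using X by (simp add: tensor_dual_def)
  ultimately have "c - X \<in> sym_tensors"
    by (rule subspace_diff[OF subspace_sym_tensors])
  \<comment> \<open>Orthogonality removes the term with \<open>c\<close> from
    \<open>ge\<close>.\<close>
  moreover have "Y \<bullet> (c - X) \<ge> 0" if "Y \<in> K" for Y
    using ge[of Y] orth that closure_subset[of K]
    by (auto simp: inner_diff_right inner_commute)
  ultimately have "c - X \<in> tensor_dual K"
    by (simp add: tensor_dual_def)
  then have "(c - X) \<bullet> X \<ge> 0"
    using X by (simp add: tensor_dual_def)
  \<comment> \<open>By \<open>orth\<close> the left side equals
    \<open>- ((c - X) \<bullet> X)\<close>.\<close>
  then have "(c - X) \<bullet> (c - X) \<le> 0"
    using orth by (simp add: inner_diff_right)
  then have "X = c"
    by (metis eq_iff_diff_eq_0 inner_ge_zero inner_eq_zero_iff order_antisym)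
  then show "X \<in> ?S"
    using c by simp
qed

lemma dual_copositive_cone: "tensor_dual copositive_cone = closure completely_positive_cone"
proof
  show "tensor_dual copositive_cone \<subseteq> closure completely_positive_cone"
    unfolding copositive_cone_eq_dual
    \<comment> \<open>The simplifier rewrites the cone to
      \<open>Collect completely_positive\<close>, so the convexity and cone facts are unfolded to
      match.\<close>
    by (rule tensor_dual_dual_subset_closure)
      (auto simp: completely_positive_cone_eq completely_positive_imp_sym completely_positive_0
        convex_completely_positive_cone[unfolded completely_positive_cone_eq]
        cone_completely_positive_cone[unfolded completely_positive_cone_eq])
  have "completely_positive_cone \<subseteq> tensor_dual copositive_cone"
    by (auto simp: completely_positive_cone_eq completely_positive_imp_sym tensor_dual_def
        copositive_cone_def inner_commute intro: order_trans[OF copositive_inner_nonneg])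
  then show "closure completely_positive_cone \<subseteq> tensor_dual copositive_cone"
    by (rule closure_minimal) (rule closed_tensor_dual)
qed

theorem mainTheorem8:
  "(copositive_cone :: ('k::finite, 'n::finite) tensor set)
       = tensor_dual completely_positive_cone
   \<and> tensor_dual (copositive_cone :: ('k, 'n) tensor set)
       = closure completely_positive_cone
   \<and> (closed (completely_positive_cone :: ('k, 'n) tensor set) \<longrightarrow>
        tensor_dual (copositive_cone :: ('k, 'n) tensor set) = completely_positive_cone)"
  \<comment> \<open>Used from right to left, the first equality keeps \<open>copositive_cone\<close>
    intact for \<open>dual_copositive_cone\<close>.\<close>
  by (simp add: copositive_cone_eq_dual[symmetric] dual_copositive_cone)

end
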